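(* Let $L,P$ be signed alphabets satisfying either $L_0<L_1$ and $P_0<P_1$, or $L_1<L_0$ and $P_1<P_0$. Let $$S=\begin{bmatrix} a_1&\ldots&a_n\\ b_1&\ldots&b_n\end{bmatrix}$$ be a signed two-rowed array on $L,P$. If $|(a_i,b_i)|=0$ for $i=1,2,\ldots,n$, then $S$ has symmetry; that is, if $S\mapsto(T,U)$ then $S'\mapsto(U,T)$.
   Context: A signed alphabet is a finite or countable totally ordered set $L$ with a map $|\cdot|:L\to\mathbb{Z}_2=\{0,1\}$; $L_0=\{a:|a|=0\}$, $L_1=\{a:|a|=1\}$. Here $L_0<L_1$ means every element of $L_0$ is smaller than every element of $L_1$ (similarly for the others). For signed alphabets $L,P$, the product $L\times P$ is a signed alphabet with the right lexicographic order, $(a_1,b_1)<(a_2,b_2)$ if $b_1<b_2$, or $b_1=b_2$ and $a_1<a_2$, and with $|(a,b)|:=|a|+|b|\in\mathbb{Z}_2$. A signed two-rowed array on $L,P$ is a $2\times n$ matrix with columns $(a_i,b_i)$, $a_i\in L$, $b_i\in P$, such that $(a_i,b_i)\le(a_{i+1},b_{i+1})$, with equality only if $|(a_i,b_i)|=0$. The array $S'$ is the signed two-rowed array on $P,L$ obtained from $S$ by exchanging its two rows and rearranging the resulting columns $(b_i,a_i)$ in weakly increasing right lexicographic order of $P\times L$. For a partition $\lambda=(\lambda_1\ge\dots\ge\lambda_m>0)$, let $D(\lambda)=\{(i,j): 1\le i\le m,\ 1\le j\le\lambda_i\}$. A super semistandard Young tableau over $L$ of shape $\lambda$ is a pair $T=(\lambda,\tau)$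 with $\tau:D(\lambda)\to L$ such that, whenever the boxes involved lie in $D(\lambda)$: (i) $\tau(i,j)\le\tau(i,j+1)$, with equality only if $|\tau(i,j)|=0$; (ii) $\tau(i,j)\le\tau(i+1,j)$, with equality only if $|\tau(i,j)|=1$. The empty tableau $\varnothing$ is admitted. Row-insertion $T\leftarrow x$: start with $i=1$. If row $i$ contains an entry $y$ with $x<y$ (in case $|x|=0$), respectively $x\le y$ (in case $|x|=1$), replace the leftmost such entry $y$ by $x$, then set $x:=y$, $i:=i+1$ and repeat. Otherwise append $x$ at the end of row $i$ (possibly a new row) and stop; output the resulting tableau and the row index $i$. Column-insertion $x\to T$: start with $j=1$. If column $j$ contains an entry $y$ with $x\le y$ (in case $|x|=0$), respectively $x<y$ (in case $|x|=1$), replace the topmost such entry $y$ by $x$, then set $x:=y$, $j:=j+1$ and repeat. Otherwise append $x$ at the bottom of column $j$ (possibly a new column) and stop; output the resulting tableau and the column index $j$. The map $S\mapsto(T,U)$ from signed two-rowed arrays on $L,P$ to pairs of super semistandard Young tableaux of the same shape, $T$ over $L$ and $U$ over $P$, is defined by: start with $T=U=\varnothing$; for $k=1,\ldots,n$, if $|b_k|=0$ replace $T$ by the tableau output of $T\leftarrow a_k$, with output row index $i$, and append $b_k$ at the end of row $i$ of $U$; if $|b_k|=1$ replace $T$ by the tableau output of $a_k\to T$, with output column index $j$, and append $b_k$ at the bottom of column $j$ of $U$. The same definition is used for arrays on $P,L$. *)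

theory Defs
  imports Main "HOL-Library.Z2" "HOL-Library.Multiset" "HOL-Library.Countable_Set"
begin

text \<open>
  A signed alphabet is given by a countable carrier \<open>L :: 'a::linorder set\<close>, ordered by the order of
  its type, and a sign map \<open>sL :: 'a \<Rightarrow> bit\<close>, where \<open>bit\<close> is the field of integers modulo 2.
\<close>

definition sign_part :: "('a \<Rightarrow> bit) \<Rightarrow> 'a set \<Rightarrow> bit \<Rightarrow> 'a set" where
  "sign_part s L e = {a \<in> L. s a = e}"

definition set_less :: "'a::linorder set \<Rightarrow> 'a set \<Rightarrow> bool" where
  "set_less A B \<longleftrightarrow> (\<forall>a\<in>A. \<forall>b\<in>B. a < b)"

definition pair_sign :: "('a \<Rightarrow> bit) \<Rightarrow> ('b \<Rightarrow> bit) \<Rightarrow> 'a \<times> 'b \<Rightarrow> bit" where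
  "pair_sign sL sP c = sL (fst c) + sP (snd c)"

definition rlex_less :: "'a::linorder \<times> 'b::linorder \<Rightarrow> 'a \<times> 'b \<Rightarrow> bool" where
  "rlex_less c d \<longleftrightarrow> snd c < snd d \<or> snd c = snd d \<and> fst c < fst d"

definition rlex_le :: "'a::linorder \<times> 'b::linorder \<Rightarrow> 'a \<times> 'b \<Rightarrow> bool" where
  "rlex_le c d \<longleftrightarrow> rlex_less c d \<or> c = d"

lemma linorder_rlex: "class.linorder rlex_le rlex_less"
  by unfold_locales (auto simp: rlex_le_def rlex_less_def prod_eq_iff)

text \<open>A two-rowed array is the list of its columns \<open>(a\<^sub>i, b\<^sub>i)\<close>.\<close>

definition signed_array ::
  "'a::linorder set \<Rightarrow> ('a \<Rightarrow> bit) \<Rightarrow> 'b::linorder set \<Rightarrow> ('b \<Rightarrow> bit) \<Rightarrow> ('a \<times> 'b) list \<Rightarrow> bool" where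
  "signed_array L sL P sP S \<longleftrightarrow>
     set S \<subseteq> L \<times> P \<and>
     successively (\<lambda>c d. rlex_le c d \<and> (c = d \<longrightarrow> pair_sign sL sP c = 0)) S"

definition exchange_rows :: "('a::linorder \<times> 'b::linorder) list \<Rightarrow> ('b \<times> 'a) list" where
  "exchange_rows S = linorder.sort_key rlex_le (\<lambda>c. c) (map prod.swap S)"

lemma exchange_rows_unique:
  fixes S :: "('a::linorder \<times> 'b::linorder) list"
  shows "S' = exchange_rows S \<longleftrightarrow> mset S' = mset (map prod.swap S) \<and> sorted_wrt rlex_le S'"
proof -
  interpret rlex: linorder "rlex_le :: 'b \<times> 'a \<Rightarrow> _" rlex_less
    by (rule linorder_rlex)
  have sort: "mset (rlex.sort_key (\<lambda>c. c) xs) = mset xs" "rlex.sorted (rlex.sort_key (\<lambda>c. c) xs)"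
    for xs
    by (rule rlex.mset_sort, rule rlex.sorted_sort)
  show ?thesis
    unfolding exchange_rows_def
  proof
    assume "S' = rlex.sort_key (\<lambda>c. c) (map prod.swap S)"
    then show "mset S' = mset (map prod.swap S) \<and> rlex.sorted S'"
      using sort[of "map prod.swap S"] by simp
  next
    assume *: "mset S' = mset (map prod.swap S) \<and> rlex.sorted S'"
    show "S' = rlex.sort_key (\<lambda>c. c) (map prod.swap S)"
      by (rule rlex.properties_for_sort[symmetric]) (use * in auto)
  qed
qed

text \<open>
  A tableau of shape \<open>\<lambda>\<close> is represented by the list of its rows, so that \<open>\<lambda>\<close> is the list of row
  lengths and \<open>\<tau>(i, j)\<close> is \<open>T ! (i - 1) ! (j - 1)\<close>; its columns are \<open>transpose T\<close>.
  Indices of rows and columns count from 0. The two insertions below keep a super semistandard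
  tableau super semistandard, and on signed arrays the correspondence started from the empty
  tableaux only produces super semistandard ones, so the type does not impose this condition.
\<close>

type_synonym 'a tableau = "'a list list"

definition row_bumps :: "('a::linorder \<Rightarrow> bit) \<Rightarrow> 'a \<Rightarrow> 'a \<Rightarrow> bool" where
  "row_bumps s x y \<longleftrightarrow> (if s x = 0 then x < y else x \<le> y)"

definition col_bumps :: "('a::linorder \<Rightarrow> bit) \<Rightarrow> 'a \<Rightarrow> 'a \<Rightarrow> bool" where
  "col_bumps s x y \<longleftrightarrow> (if s x = 0 then x \<le> y else x < y)"

text \<open>
  Insertion into a list of lines (the rows or the columns of a tableau), where \<open>q x y\<close> says that
  \<open>x\<close> displaces \<open>y\<close>. The second component of the result is the index of the line that has grown.
\<close>

fun bump_insert :: "('a \<Rightarrow> 'a \<Rightarrow> bool) \<Rightarrow> 'a \<Rightarrow> 'a list list \<Rightarrow> 'a list list \<times> nat" where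
  "bump_insert q x [] = ([[x]], 0)"
| "bump_insert q x (l # ls) =
     (case dropWhile (\<lambda>y. \<not> q x y) l of
        [] \<Rightarrow> ((l @ [x]) # ls, 0)
      | y # zs \<Rightarrow>
          (let (ls', i) = bump_insert q y ls
           in ((takeWhile (\<lambda>y. \<not> q x y) l @ x # zs) # ls', Suc i)))"

definition row_insert :: "('a::linorder \<Rightarrow> bit) \<Rightarrow> 'a tableau \<Rightarrow> 'a \<Rightarrow> 'a tableau \<times> nat" where
  "row_insert s T x = bump_insert (row_bumps s) x T"

definition col_insert :: "('a::linorder \<Rightarrow> bit) \<Rightarrow> 'a \<Rightarrow> 'a tableau \<Rightarrow> 'a tableau \<times> nat" where
  "col_insert s x T =
     (let (C, j) = bump_insert (col_bumps s) x (transpose T) in (transpose C, j))"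

definition append_to_row :: "'a \<Rightarrow> nat \<Rightarrow> 'a tableau \<Rightarrow> 'a tableau" where
  "append_to_row b i U = (if i < length U then U[i := U ! i @ [b]] else U @ [[b]])"

definition append_to_col :: "'a \<Rightarrow> nat \<Rightarrow> 'a tableau \<Rightarrow> 'a tableau" where
  "append_to_col b j U = transpose (append_to_row b j (transpose U))"

fun super_RSK_step ::
  "('a::linorder \<Rightarrow> bit) \<Rightarrow> ('b::linorder \<Rightarrow> bit) \<Rightarrow>
     'a tableau \<times> 'b tableau \<Rightarrow> 'a \<times> 'b \<Rightarrow> 'a tableau \<times> 'b tableau" where
  "super_RSK_step sL sP (T, U) (a, b) =
     (if sP b = 0
      then let (T', i) = row_insert sL T a in (T', append_to_row b i U)
      else let (T', j) = col_insert sL a T in (T', append_to_col b j U))"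

definition super_RSK ::
  "('a::linorder \<Rightarrow> bit) \<Rightarrow> ('b::linorder \<Rightarrow> bit) \<Rightarrow> ('a \<times> 'b) list \<Rightarrow> 'a tableau \<times> 'b tableau" where
  "super_RSK sL sP S = foldl (super_RSK_step sL sP) ([], []) S"

end

theory Submission
  imports Defs
begin

text \<open>
  When every column \<open>(a, b)\<close> of the array has \<open>|a| = |b|\<close>, the letters with \<open>|b| = 0\<close> are inserted by
  rows and displace by \<open><\<close>, and those with \<open>|b| = 1\<close> are inserted by columns and again displace by
  \<open><\<close>. The order hypothesis makes all columns of one sign precede those of the other, in both rows
  of the array. So the super correspondence runs in two phases, each of which is the ordinary
  Robinson-Schensted-Knuth correspondence \<open>rsk\<close>, on the rows or on the columns of the tableau.

  The letters of the second phase are larger than those already present, hence never displace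
  them. If the second phase works on columns, say, it therefore just lengthens the columns
  of the first tableau by the lines of the tableau that \<open>rsk\<close> makes from the second part of
  the array alone (\<open>bump_insert_append_lines\<close>). The final pair is a function of the values of
  \<open>rsk\<close> on the two parts, the same function for \<open>T\<close> and for \<open>U\<close> (\<open>super_RSK_even_first\<close>,
  \<open>super_RSK_odd_first\<close>). Exchanging the rows of the array respects the two parts, so the theorem
  follows from the classical symmetry of \<open>rsk\<close>.

  That symmetry (\<open>rsk_symmetric\<close>) is proved by induction on the number of columns. Let \<open>(b, a)\<close>
  be the last column of the exchanged array, so that \<open>a\<close> is the largest upper letter of the given
  one. If \<open>(a, b)\<close> is deleted and the rest maps to \<open>(T, U)\<close>, then the given array maps to the pair
  obtained by inserting \<open>b\<close> into \<open>U\<close> and appending \<open>a\<close> to the row of \<open>T\<close> in which \<open>U\<close> has grown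
  (\<open>rsk_insert_max\<close>); this is what the last step does on the exchanged array. The claim holds
  when \<open>(a, b)\<close> has just been inserted and is preserved by every later insertion, because inserting
  a letter commutes with appending a maximal one, up to a collision in which the maximal letter
  moves one row down (\<open>bump_insert_append_max\<close>). That lemma is applied to \<open>T\<close> and to \<open>U\<close>, and the
  two collisions occur together.
\<close>

section \<open>Insertion into a list of lines\<close>

lemma bump_insert_append:
  "\<forall>z\<in>set l. \<not> q x z \<Longrightarrow> bump_insert q x (l # ls) = ((l @ [x]) # ls, 0)"
  by (simp add: dropWhile_eq_Nil_conv[THEN iffD2])

lemma bump_insert_bump:
  assumes "\<forall>z\<in>set u. \<not> q x z" and "q x y" and "bump_insert q y ls = (ls', i)"
  shows "bump_insert q x ((u @ y # zs) # ls) = ((u @ x # zs) # ls', Suc i)"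
proof -
  have "dropWhile (\<lambda>y. \<not> q x y) (u @ y # zs) = y # zs"
    using assms by (subst dropWhile_append2) auto
  moreover have "takeWhile (\<lambda>y. \<not> q x y) (u @ y # zs) = u"
    using assms by (subst takeWhile_append2) auto
  ultimately show ?thesis using assms(3) by simp
qed

text \<open>The two preceding lemmas replace the recursive equation.\<close>

declare bump_insert.simps(2) [simp del]

lemma line_cases:
  obtains (append) "\<forall>z\<in>set l. \<not> q x z"
  | (bump) u y zs where "l = u @ y # zs" "\<forall>z\<in>set u. \<not> q x z" "q x y"
  using split_list_first_prop[of l "q x"] by blast

lemma append_to_row_simps [simp]:
  "append_to_row b 0 [] = [[b]]"
  "append_to_row b 0 (l # ls) = (l @ [b]) # ls"
  "append_to_row b (Suc i) (l # ls) = l # append_to_row b i ls"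
  by (simp_all add: append_to_row_def)

lemma bump_insert_index_le: "bump_insert q x T = (T', i) \<Longrightarrow> i \<le> length T"
proof (induction T arbitrary: x T' i)
  case (Cons l ls)
  show ?case
  proof (cases rule: line_cases[of l q x])
    case append
    then show ?thesis using Cons.prems bump_insert_append[of l q x ls] by simp
  next
    case (bump u y zs)
    obtain ls' j where j: "bump_insert q y ls = (ls', j)" by fastforce
    then show ?thesis
      using bump_insert_bump[OF bump(2,3) j, of zs] bump(1) Cons.IH[OF j] Cons.prems by simp
  qed
qed simp

lemma map_length_append_to_row:
  "map length T = map length U \<Longrightarrow> map length (append_to_row a i T) = map length (append_to_row b i U)"
  by (auto simp: append_to_row_def map_update dest: map_eq_imp_length_eq intro!: arg_cong2[of _ _ _ _ list_update])
     (metis length_map nth_map)+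

lemma bump_insert_shape:
  assumes "bump_insert q x T = (T', i)"
  shows "map length T' = map length (append_to_row b i T)"
  using assms
proof (induction T arbitrary: x T' i)
  case (Cons l ls)
  show ?case
  proof (cases rule: line_cases[of l q x])
    case append
    then show ?thesis using Cons.prems bump_insert_append[of l q x ls] by auto
  next
    case (bump u y zs)
    obtain ls' j where j: "bump_insert q y ls = (ls', j)" by fastforce
    then show ?thesis
      using bump_insert_bump[OF bump(2,3) j, of zs] bump(1) Cons.IH[OF j] Cons.prems by auto
  qed
qed auto

text \<open>Letters only move down: the first \<open>r\<close> lines receive nothing but \<open>x\<close> from outside.\<close>

lemma bump_insert_entries_take:
  assumes "bump_insert q x T = (T', i)"
  shows "set (concat (take r T')) \<subseteq> insert x (set (concat (take r T)))"
  using assms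
proof (induction T arbitrary: x T' i r)
  case Nil
  then show ?case by (cases r) auto
next
  case (Cons l ls)
  show ?case
  proof (cases r)
    case (Suc r')
    show ?thesis
    proof (cases rule: line_cases[of l q x])
      case append
      then show ?thesis using Cons.prems bump_insert_append[of l q x ls] Suc by auto
    next
      case (bump u y zs)
      obtain ls' j where j: "bump_insert q y ls = (ls', j)" by fastforce
      then show ?thesis
        using bump_insert_bump[OF bump(2,3) j, of zs] bump(1) Cons.IH[OF j, of r'] Cons.prems Suc
        by (auto simp del: set_concat)
    qed
  qed simp
qed

lemma bump_insert_entries:
  assumes "bump_insert q x T = (T', i)"
  shows "set (concat T') \<subseteq> insert x (set (concat T))"
  using bump_insert_entries_take[OF assms, of "length T + length T'"] by simp

lemma entries_append_to_row: "set (concat (append_to_row b i U)) \<subseteq> insert b (set (concat U))"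
  by (auto simp: append_to_row_def split: if_splits dest!: set_update_subset_insert[THEN subsetD])

lemma take_append_to_row: "i \<le> length U \<Longrightarrow> r \<le> i \<Longrightarrow> take r (append_to_row b i U) = take r U"
  by (auto simp: append_to_row_def)

lemma bump_insert_max:
  fixes m :: "'a::linorder"
  assumes "\<forall>y\<in>set (concat T). y \<le> m"
  shows "bump_insert (<) m T = (append_to_row m 0 T, 0)"
proof (cases T)
  case (Cons l ls)
  then have "\<forall>z\<in>set l. \<not> m < z" using assms by (simp add: not_less)
  then show ?thesis using Cons bump_insert_append by simp
qed simp

text \<open>
  Appending a maximal letter \<open>m\<close> to line \<open>r\<close> does not affect the path of a smaller letter \<open>x\<close>, unless
  this path ends in line \<open>r\<close>; then \<open>m\<close> is displaced and comes to rest in line \<open>r + 1\<close>. There may be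
  further entries equal to \<open>m\<close>, but only in lines \<open>r\<close> and below: an \<open>m\<close> arriving in line \<open>r\<close>
  would not displace the appended one. The last conjunct keeps this hypothesis alive after a
  collision.
\<close>

lemma bump_insert_append_max:
  fixes m :: "'a::linorder"
  assumes "bump_insert (<) x T = (T', s)" and "x < m" and "\<forall>y\<in>set (concat T). y \<le> m"
    and "\<forall>y\<in>set (concat (take r T)). y < m" and "r \<le> length T"
  shows "bump_insert (<) x (append_to_row m r T) =
           (if s = r then (append_to_row m (Suc r) T', Suc r) else (append_to_row m r T', s))
         \<and> (s = r \<longrightarrow> (\<forall>y\<in>set (concat (take (Suc r) T')). y < m))"
  using assms
proof (induction T arbitrary: x T' s r)
  case Nil
  then show ?case using bump_insert_bump[of "[]" "(<)" x m "[]" "[[m]]" 0 "[]"] by auto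
next
  case (Cons l ls)
  show ?case
  proof (cases r)
    case 0
    show ?thesis
    proof (cases rule: line_cases[of l "(<)" x])
      case append
      \<comment> \<open>The collision: \<open>x\<close> takes the place of \<open>m\<close>, which is appended to the next line.\<close>
      have *: "bump_insert (<) m ls = (append_to_row m 0 ls, 0)"
        by (rule bump_insert_max) (use Cons.prems in auto)
      have "bump_insert (<) x ((l @ [m]) # ls) = ((l @ [x]) # append_to_row m 0 ls, Suc 0)"
        using bump_insert_bump[where q="(<)", OF append Cons.prems(2) *, of "[]"] by simp
      then show ?thesis
        using 0 append bump_insert_append[where q="(<)", OF append, of ls] Cons.prems by (auto simp: not_less)
    next
      case (bump u y zs)
      obtain ls' j where j: "bump_insert (<) y ls = (ls', j)" by fastforce
      show ?thesis
        using bump_insert_bump[where q="(<)", OF bump(2,3) j, of zs] bump_insert_bump[where q="(<)", OF bump(2,3) j, of "zs @ [m]"]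
          0 bump(1) Cons.prems(1) by auto
    qed
  next
    case (Suc r')
    show ?thesis
    proof (cases rule: line_cases[of l "(<)" x])
      case append
      then show ?thesis
        using Suc bump_insert_append[where q="(<)", OF append] Cons.prems(1) by auto
    next
      case (bump u y zs)
      obtain ls' j where j: "bump_insert (<) y ls = (ls', j)" by fastforce
      have m: "y < m" using Cons.prems(4) bump(1) Suc by auto
      obtain V k where V: "bump_insert (<) y (append_to_row m r' ls) = (V, k)" by fastforce
      have IH: "(V, k) = (if j = r' then (append_to_row m (Suc r') ls', Suc r') else (append_to_row m r' ls', j))
         \<and> (j = r' \<longrightarrow> (\<forall>y\<in>set (concat (take (Suc r') ls')). y < m))"
        using Cons.IH[OF j m, of r'] Cons.prems V Suc by auto
      show ?thesis
        using bump_insert_bump[where q="(<)", OF bump(2,3) j, of zs] bump_insert_bump[where q="(<)", OF bump(2,3) V, of zs] IH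
          Suc bump(1) Cons.prems m by (auto split: if_splits)
    qed
  qed
qed

section \<open>Semistandard tableaux\<close>

text \<open>
  \<open>l\<close> can stand above the first line of \<open>ls\<close> in a tableau with strictly increasing columns; if \<open>ls\<close>
  is empty, there is nothing to require.
\<close>

definition above :: "'a::linorder list \<Rightarrow> 'a list list \<Rightarrow> bool" where
  "above l ls \<longleftrightarrow> (\<forall>m ms. ls = m # ms \<longrightarrow> length m \<le> length l \<and> (\<forall>j<length m. l ! j < m ! j))"

text \<open>
  Ordinary semistandard tableaux: nonempty weakly increasing rows, strictly increasing columns.
\<close>

fun semistandard :: "'a::linorder list list \<Rightarrow> bool" where
  "semistandard [] \<longleftrightarrow> True"
| "semistandard (l # ls) \<longleftrightarrow> l \<noteq> [] \<and> sorted l \<and> above l ls \<and> semistandard ls"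

lemma semistandard_bump_insert:
  assumes "semistandard T" and "bump_insert (<) x T = (T', i)"
  shows "semistandard T'"
  using assms
proof (induction T arbitrary: x T' i)
  case Nil
  then show ?case by (auto simp: above_def)
next
  case (Cons l ls)
  show ?case
  proof (cases rule: line_cases[of l "(<)" x])
    case append
    have "above (l @ [x]) ls"
      using Cons.prems(1) by (auto simp: above_def nth_append)
    then show ?thesis
      using append bump_insert_append[where q="(<)", OF append, of ls] Cons.prems
      by (auto simp: sorted_append not_less)
  next
    case (bump u y zs)
    obtain ls' j where j: "bump_insert (<) y ls = (ls', j)" by fastforce
    have T': "T' = (u @ x # zs) # ls'"
      using bump_insert_bump[where q="(<)", OF bump(2,3) j, of zs] bump(1) Cons.prems(2) by auto
    have sl: "semistandard ls'" using Cons.IH[OF _ j] Cons.prems(1) by simp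
    have le: "(u @ x # zs) ! k < y" if "k \<le> length u" for k
    proof (cases "k = length u")
      case False
      then have "k < length u" using that by simp
      then have "(u @ x # zs) ! k \<in> set u" by (simp add: nth_append)
      then show ?thesis using bump(2,3) by (auto simp: not_less)
    qed (use bump in auto)
    have low: "(u @ x # zs) ! k \<le> l ! k" if "k < length l" for k
      using bump that by (auto simp: nth_append nth_Cons' less_imp_le)
    have "sorted (u @ x # zs)"
      using Cons.prems(1) bump by (fastforce simp: sorted_append not_less)
    moreover have "above (u @ x # zs) ls'"
    proof (cases ls)
      case Nil
      then show ?thesis using j le[of 0] by (auto simp: above_def)
    next
      case (Cons m ms)
      have ab: "length m \<le> length l" "\<And>k. k < length m \<Longrightarrow> l ! k < m ! k"
        using Cons.prems(1) Cons by (auto simp: above_def)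
      have low': "(u @ x # zs) ! k < m ! k" if "k < length m" for k
        using low[of k] ab(2)[OF that] ab(1) that by auto
      \<comment> \<open>By the strict columns, \<open>y\<close> does not move to the right when it passes to the next row.\<close>
      have pos: "p \<le> length u" if "\<forall>k<p. m ! k \<le> y" "p \<le> length m" for p
      proof (rule ccontr)
        assume "\<not> p \<le> length u"
        then have "m ! length u \<le> y" "length u < length m" using that by auto
        then show False using ab(2)[of "length u"] bump(1) by auto
      qed
      show ?thesis
      proof (cases rule: line_cases[of m "(<)" y])
        case append
        have "length m \<le> length u"
          by (rule pos) (use append in \<open>auto simp: not_less\<close>)
        then have "(u @ x # zs) ! k < (m @ [y]) ! k" if "k < Suc (length m)" for k
          using low'[of k] le[of k] that
          by (cases "k = length m") (simp_all add: nth_append[of m "[y]"])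
        then show ?thesis
          using bump_insert_append[where q="(<)", OF append, of ms] j Cons ab(1) bump
            \<open>length m \<le> length u\<close> by (auto simp: above_def)
      next
        case (bump v z ws)
        have v: "length v \<le> length u"
          by (rule pos) (use bump in \<open>auto simp: not_less nth_append\<close>)
        obtain ms' j' where j': "bump_insert (<) z ms = (ms', j')" by fastforce
        have "ls' = (v @ y # ws) # ms'"
          using bump_insert_bump[where q="(<)", OF bump(2,3) j', of ws] j Cons bump(1) by auto
        moreover have "(u @ x # zs) ! k < (v @ y # ws) ! k" if "k < length m" for k
          using low'[OF that] le[of k] v bump(1) that
          by (cases "k = length v") (auto simp: nth_append nth_Cons')
        ultimately show ?thesis using ab(1) bump(1) \<open>l = u @ y # zs\<close> by (auto simp: above_def)
      qed
    qed
    ultimately show ?thesis using T' sl by simp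
  qed
qed

text \<open>The row bumping lemma: weakly increasing insertions grow lines of weakly decreasing index.\<close>

lemma row_bumping:
  fixes x :: "'a::linorder"
  assumes "\<forall>l\<in>set T. sorted l" and "x \<le> x'"
    and "bump_insert (<) x T = (T', s)" and "bump_insert (<) x' T' = (T'', s')"
  shows "s' \<le> s"
  using assms
proof (induction T arbitrary: x x' T' T'' s s')
  case Nil
  then have "\<forall>z\<in>set [x]. \<not> x' < z" by auto
  from bump_insert_append[where q="(<)", OF this, of "[]"] show ?case using Nil by auto
next
  case (Cons l ls)
  show ?case
  proof (cases rule: line_cases[of l "(<)" x])
    case append
    then have "\<forall>z\<in>set (l @ [x]). \<not> x' < z" using Cons.prems(2) by auto
    from bump_insert_append[where q="(<)", OF this] bump_insert_append[where q="(<)", OF append] show ?thesis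
      using Cons.prems by auto
  next
    case (bump u y zs)
    obtain ls' j where j: "bump_insert (<) y ls = (ls', j)" by fastforce
    have T': "T' = (u @ x # zs) # ls'" "s = Suc j"
      using bump_insert_bump[where q="(<)", OF bump(2,3) j, of zs] bump(1) Cons.prems(3) by auto
    \<comment> \<open>As \<open>x \<le> x'\<close>, the letter \<open>x'\<close> acts to the right of the position taken by \<open>x\<close>.\<close>
    have ux: "\<forall>z\<in>set (u @ [x]). \<not> x' < z" using bump(2) Cons.prems(2) by auto
    show ?thesis
    proof (cases rule: line_cases[of zs "(<)" x'])
      case append
      then have "\<forall>z\<in>set (u @ x # zs). \<not> x' < z" using ux by auto
      from bump_insert_append[where q="(<)", OF this] show ?thesis using Cons.prems(4) T' by auto
    next
      case (bump v y' ws)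
      obtain ls'' j' where j': "bump_insert (<) y' ls' = (ls'', j')" by fastforce
      have "\<forall>z\<in>set (u @ x # v). \<not> x' < z" using ux bump by auto
      from bump_insert_bump[where q="(<)", OF this bump(3) j', of ws] have "s' = Suc j'"
        using Cons.prems(4) T' bump(1) by auto
      moreover have "y \<le> y'"
        using Cons.prems(1) \<open>l = u @ y # zs\<close> bump(1) by (auto simp: sorted_append)
      ultimately show ?thesis using Cons.IH[OF _ _ j j'] Cons.prems(1) T' by auto
    qed
  qed
qed

section \<open>The Robinson-Schensted-Knuth correspondence and its symmetry\<close>

text \<open>
  One step of the ordinary correspondence: \<open>a\<close> is inserted into the lines of \<open>T\<close>, displacing strictly
  larger entries, and \<open>b\<close> records the line that has grown. The lines are read as rows or as columns
  later on.
\<close>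

fun rsk_step ::
  "'a::linorder tableau \<times> 'b tableau \<Rightarrow> 'a \<times> 'b \<Rightarrow> 'a tableau \<times> 'b tableau" where
  "rsk_step (T, U) (a, b) = (let (T', i) = bump_insert (<) a T in (T', append_to_row b i U))"

text \<open>The ordinary correspondence on a two-rowed array, without signs.\<close>

definition rsk :: "('a::linorder \<times> 'b) list \<Rightarrow> 'a tableau \<times> 'b tableau" where
  "rsk S = foldl rsk_step ([], []) S"

lemma rsk_Nil [simp]: "rsk [] = ([], [])"
  by (simp add: rsk_def)

lemma rsk_snoc [simp]: "rsk (S @ [c]) = rsk_step (rsk S) c"
  by (simp add: rsk_def)

lemma rsk_invariants:
  assumes "rsk S = (T, U)"
  shows "semistandard T \<and> map length T = map length U \<and>
    set (concat T) \<subseteq> fst ` set S \<and> set (concat U) \<subseteq> snd ` set S"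
  using assms
proof (induction S arbitrary: T U rule: rev_induct)
  case (snoc c S)
  obtain T0 U0 where 0: "rsk S = (T0, U0)" by fastforce
  obtain T' i where i: "bump_insert (<) (fst c) T0 = (T', i)" by fastforce
  have TU: "T = T'" "U = append_to_row (snd c) i U0"
    using snoc.prems 0 i by (cases c; simp)+
  note IH = snoc.IH[OF 0]
  have "semistandard T" using semistandard_bump_insert[OF _ i] IH TU by simp
  moreover have "map length T = map length U"
    using bump_insert_shape[OF i] map_length_append_to_row[of T0 U0] IH TU by metis
  moreover have "set (concat T) \<subseteq> fst ` set (S @ [c])"
    using bump_insert_entries[OF i] IH TU by auto
  moreover have "set (concat U) \<subseteq> snd ` set (S @ [c])"
    using entries_append_to_row[of "snd c" i U0] IH TU by (auto simp del: set_concat)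
  ultimately show ?case by blast
qed simp

lemma rsk_length_eq: "rsk S = (T, U) \<Longrightarrow> length T = length U"
  using rsk_invariants map_eq_imp_length_eq by blast

lemma semistandard_sorted: "semistandard T \<Longrightarrow> \<forall>l\<in>set T. sorted l"
  by (induction T) auto

lemma rlex_le_snd: "rlex_le c d \<Longrightarrow> snd c \<le> snd d"
  by (auto simp: rlex_le_def rlex_less_def)

text \<open>
  When \<open>b\<close> is about to be appended to line \<open>s\<close> of \<open>U\<close>, the earlier copies of \<open>b\<close> are in lines \<open>s\<close>
  and below, by the row bumping lemma. This is the hypothesis that \<open>bump_insert_append_max\<close> needs
  on \<open>U\<close>.
\<close>

lemma rsk_new_index:
  assumes "sorted_wrt rlex_le (S @ [(a, b)])" and "rsk S = (T, U)"
    and "bump_insert (<) a T = (T', s)"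
  shows "\<forall>y\<in>set (concat (take s U)). y < b"
  using assms
proof (induction S arbitrary: a b T U T' s rule: rev_induct)
  case (snoc c S)
  obtain a0 b0 where c: "c = (a0, b0)" by fastforce
  obtain T0 U0 where 0: "rsk S = (T0, U0)" by fastforce
  obtain T1 s0 where 1: "bump_insert (<) a0 T0 = (T1, s0)" by fastforce
  have TU: "T = T1" "U = append_to_row b0 s0 U0" using snoc.prems(2) c 0 1 by auto
  have le: "rlex_le (a0, b0) (a, b)" and le': "\<forall>d\<in>set (S @ [c]). snd d \<le> b0"
    using snoc.prems(1) c by (auto simp: sorted_wrt_append rlex_le_def rlex_less_def)
  show ?case
  proof (cases "b0 < b")
    case True
    have "set (concat U) \<subseteq> snd ` set (S @ [c])" using rsk_invariants[OF snoc.prems(2)] by blast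
    moreover have "set (concat (take s U)) \<subseteq> set (concat U)" by (auto dest: in_set_takeD)
    ultimately show ?thesis using True le' by fastforce
  next
    case False
    then have eq: "b0 = b" "a0 \<le> a" using le by (auto simp: rlex_le_def rlex_less_def)
    have "s \<le> s0"
      using row_bumping[OF semistandard_sorted eq(2) 1] rsk_invariants[OF 0] snoc.prems(3) TU by auto
    moreover have "s0 \<le> length U0"
      using bump_insert_index_le[OF 1] rsk_length_eq[OF 0] by simp
    ultimately have "take s U = take s U0" using TU take_append_to_row by auto
    moreover have "\<forall>y\<in>set (concat (take s0 U0)). y < b0"
      using snoc.IH[OF _ 0 1] snoc.prems(1) c by (auto simp: sorted_wrt_append)
    moreover have "set (take s U0) \<subseteq> set (take s0 U0)"
      using \<open>s \<le> s0\<close> by (rule set_take_subset_set_take)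
    ultimately show ?thesis using eq by auto
  qed
qed simp

text \<open>
  The effect of one more column \<open>(a, b)\<close>, where \<open>a\<close> is maximal and this is its last occurrence. The
  second conjunct of the conclusion is the hypothesis of \<open>bump_insert_append_max\<close> on \<open>T\<close>, carried
  through the induction.
\<close>

lemma rsk_insert_max:
  fixes a :: "'a::linorder" and b :: "'b::linorder"
  assumes "sorted_wrt rlex_le (S1 @ (a, b) # S2)"
    and "\<forall>c\<in>set S1. fst c \<le> a" and "\<forall>c\<in>set S2. fst c < a"
    and "rsk (S1 @ S2) = (T, U)" and "bump_insert (<) b U = (U', r)"
  shows "rsk (S1 @ (a, b) # S2) = (append_to_row a r T, U') \<and> (\<forall>y\<in>set (concat (take r T)). y < a)"
  using assms
proof (induction S2 arbitrary: T U U' r rule: rev_induct)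
  case Nil
  note inv = rsk_invariants[OF Nil(4)[simplified]]
  have "bump_insert (<) a T = (append_to_row a 0 T, 0)"
    by (rule bump_insert_max) (use inv Nil(2) in blast)
  moreover have "\<forall>c\<in>set S1. snd c \<le> b"
    using Nil(1) by (auto simp: sorted_wrt_append dest!: rlex_le_snd)
  then have "bump_insert (<) b U = (append_to_row b 0 U, 0)"
    by (intro bump_insert_max) (use inv in blast)
  ultimately show ?case using Nil(4,5) by auto
next
  case (snoc c S2)
  obtain a' b' where c: "c = (a', b')" by fastforce
  obtain T0 U0 where 0: "rsk (S1 @ S2) = (T0, U0)" by fastforce
  obtain U0' r0 where b: "bump_insert (<) b U0 = (U0', r0)" by fastforce
  obtain T1 s where a': "bump_insert (<) a' T0 = (T1, s)" by fastforce
  have IH: "rsk (S1 @ (a, b) # S2) = (append_to_row a r0 T0, U0')"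
    "\<forall>y\<in>set (concat (take r0 T0)). y < a"
    using snoc.IH[OF _ _ _ 0 b] snoc.prems c by (auto simp: sorted_wrt_append)
  have "rsk ((S1 @ S2) @ [c]) = (T1, append_to_row b' s U0)" using 0 a' c by (simp only: rsk_snoc) simp
  then have TU: "T = T1" "U = append_to_row b' s U0" using snoc.prems(4) by simp_all
  have lt: "a' < a" "b < b'"
    using snoc.prems(1,3) c by (auto simp: sorted_wrt_append rlex_le_def rlex_less_def)
  note inv = rsk_invariants[OF 0] rsk_length_eq[OF 0]
  have idx: "r0 \<le> length T0" "s \<le> length U0"
    using bump_insert_index_le[OF b] bump_insert_index_le[OF a'] inv by auto
  have "\<forall>c\<in>set (S1 @ S2). fst c \<le> a" using snoc.prems(2,3) by (auto simp: less_imp_le)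
  then have "\<forall>y\<in>set (concat T0). y \<le> a" using inv by blast
  \<comment> \<open>On \<open>T\<close> the letter \<open>a'\<close> is inserted past the appended \<open>a\<close>, on \<open>U\<close> the letter \<open>b\<close> past \<open>b'\<close>.\<close>
  note A = bump_insert_append_max[OF a' lt(1) this IH(2) idx(1)]
  have "\<forall>c\<in>set (S1 @ S2). snd c \<le> b'"
    using snoc.prems(1) c by (auto simp: sorted_wrt_append dest!: rlex_le_snd)
  then have "\<forall>y\<in>set (concat U0). y \<le> b'" using inv by blast
  moreover have "\<forall>y\<in>set (concat (take s U0)). y < b'"
    by (rule rsk_new_index[OF _ 0 a']) (use snoc.prems(1) c in \<open>auto simp: sorted_wrt_append\<close>)
  ultimately have B: "bump_insert (<) b (append_to_row b' s U0) =
      (if r0 = s then (append_to_row b' (Suc s) U0', Suc s) else (append_to_row b' s U0', r0))"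
    using bump_insert_append_max[OF b lt(2) _ _ idx(2)] by blast
  have split: "rsk (S1 @ (a, b) # S2 @ [c]) = rsk_step (append_to_row a r0 T0, U0') (a', b')"
    using IH(1) c rsk_snoc[of "S1 @ (a, b) # S2" c] by simp
  show ?case
  proof (cases "r0 = s")
    case True
    then show ?thesis using A B split TU snoc.prems(5) by auto
  next
    case False
    moreover have "\<forall>y\<in>set (concat (take r0 T1)). y < a"
      using bump_insert_entries_take[OF a', of r0] IH(2) lt(1) by blast
    ultimately show ?thesis using A B split TU snoc.prems(5) by auto
  qed
qed

lemma rlex_le_refl: "rlex_le c c"
  by (simp add: rlex_le_def)

lemma rlex_le_trans: "rlex_le c d \<Longrightarrow> rlex_le d e \<Longrightarrow> rlex_le c e"
  by (auto simp: rlex_le_def rlex_less_def)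

lemma mset_exchange_rows: "mset (exchange_rows S) = mset (map prod.swap S)"
  and sorted_exchange_rows: "sorted_wrt rlex_le (exchange_rows S)"
  using exchange_rows_unique by blast+

lemma rsk_symmetric:
  assumes "sorted_wrt rlex_le S" and "rsk S = (T, U)"
  shows "rsk (exchange_rows S) = (U, T)"
  using assms
proof (induction "length S" arbitrary: S T U)
  case 0
  then show ?case using mset_exchange_rows[of S] by auto
next
  case (Suc n)
  have "exchange_rows S \<noteq> []" using Suc(2) mset_exchange_rows[of S] by auto
  then obtain S' b a where S': "exchange_rows S = S' @ [(b, a)]"
    by (metis rev_exhaust surj_pair)
  have "set (exchange_rows S) = prod.swap ` set S"
    using mset_exchange_rows[of S] by (metis set_map set_mset_mset)
  then have sw: "d \<in> set S \<longleftrightarrow> prod.swap d \<in> set (exchange_rows S)" for d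
    by (simp add: inj_image_mem_iff)
  then have "(a, b) \<in> set S" using S' by auto
  \<comment> \<open>The last copy of \<open>(a, b)\<close>, so that every later upper letter is smaller than \<open>a\<close>.\<close>
  then obtain S1 S2 where S: "S = S1 @ (a, b) # S2" "(a, b) \<notin> set S2"
    by (auto dest: split_list_last)
  have "rlex_le (prod.swap d) (b, a)" if "d \<in> set S" for d
    using sorted_exchange_rows[of S] S' that sw[of d] by (auto simp: sorted_wrt_append rlex_le_refl)
  then have max: "fst d < a \<or> fst d = a \<and> snd d \<le> b" if "d \<in> set S" for d
    using that by (cases d) (force simp: rlex_le_def rlex_less_def)
  have S1: "\<forall>c\<in>set S1. fst c \<le> a" using max S(1) by (auto simp: less_imp_le) force
  have S2: "\<forall>c\<in>set S2. fst c < a"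
  proof
    fix c assume c: "c \<in> set S2"
    then have "rlex_le (a, b) c" using Suc.prems(1) S(1) by (simp add: sorted_wrt_append)
    then show "fst c < a" using max[of c] c S by (cases c) (auto simp: rlex_le_def rlex_less_def)
  qed
  obtain T0 U0 where 0: "rsk (S1 @ S2) = (T0, U0)" by fastforce
  have "mset S' = mset (map prod.swap (S1 @ S2))"
    using mset_exchange_rows[of S] S' S(1) by simp
  moreover have "sorted_wrt rlex_le S'"
    using sorted_exchange_rows[of S] S' by (simp add: sorted_wrt_append)
  ultimately have ex: "S' = exchange_rows (S1 @ S2)" using exchange_rows_unique by blast
  have "rsk S' = (U0, T0)"
    unfolding ex by (rule Suc.hyps(1)[OF _ _ 0]) (use Suc.hyps(2) Suc.prems(1) S(1) in \<open>auto simp: sorted_wrt_append\<close>)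
  moreover obtain U' r where r: "bump_insert (<) b U0 = (U', r)" by fastforce
  ultimately have "rsk (exchange_rows S) = (U', append_to_row a r T0)" using S' by simp
  moreover have "rsk S = (append_to_row a r T0, U')"
    using rsk_insert_max[OF _ S1 S2 0 r] Suc.prems(1) S(1) by blast
  ultimately show ?case using Suc.prems(2) by simp
qed


section \<open>Lines lengthened by a second correspondence\<close>

text \<open>
  The lines of \<open>C\<close> lengthened by the lines of \<open>D\<close>; on shapes this is the sum of partitions.
\<close>

fun append_lines :: "'a list list \<Rightarrow> 'a list list \<Rightarrow> 'a list list" where
  "append_lines [] D = D"
| "append_lines (c # C) [] = c # C"
| "append_lines (c # C) (d # D) = (c @ d) # append_lines C D"

lemma append_lines_Nil [simp]: "append_lines C [] = C"
  by (cases C) auto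

lemma bump_insert_cong:
  assumes "\<forall>y\<in>insert x (set (concat D)). \<forall>z\<in>set (concat D). q y z \<longleftrightarrow> q' y z"
  shows "bump_insert q x D = bump_insert q' x D"
  using assms
proof (induction D arbitrary: x)
  case (Cons l ls)
  show ?case
  proof (cases rule: line_cases[of l q' x])
    case append
    then have "\<forall>z\<in>set l. \<not> q x z" using Cons.prems by simp
    from bump_insert_append[of l q, OF this] bump_insert_append[of l q', OF append] show ?thesis by simp
  next
    case (bump u y zs)
    obtain ls' j where j: "bump_insert q' y ls = (ls', j)" by fastforce
    have "bump_insert q y ls = bump_insert q' y ls"
    proof (rule Cons.IH)
      have "insert y (set (concat ls)) \<subseteq> set (concat (l # ls))" using bump(1) by auto
      then show "\<forall>y\<in>insert y (set (concat ls)). \<forall>z\<in>set (concat ls). q y z \<longleftrightarrow> q' y z"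
        using Cons.prems by blast
    qed
    then have j': "bump_insert q y ls = (ls', j)" using j by simp
    have u: "\<forall>z\<in>set u. \<not> q x z" "q x y" using bump Cons.prems by simp_all
    show ?thesis
      using bump_insert_bump[of u q, OF u j', of zs] bump_insert_bump[of u q', OF bump(2,3) j, of zs]
        bump(1) by simp
  qed
qed simp

text \<open>
  Letters that can displace no entry of \<open>C\<close> pass over it, and are inserted into the added lines as if
  \<open>C\<close> were absent.
\<close>

lemma bump_insert_append_lines:
  assumes "\<forall>y\<in>insert x (set (concat D)).
      (\<forall>c\<in>set (concat C). \<not> q y c) \<and> (\<forall>z\<in>set (concat D). q y z \<longleftrightarrow> q' y z)"
    and "bump_insert q' x D = (D', i)"
  shows "bump_insert q x (append_lines C D) = (append_lines C D', i)"
  using assms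
proof (induction C D arbitrary: x D' i rule: append_lines.induct)
  case (1 D)
  then show ?case using bump_insert_cong[of x D q q'] by simp
next
  case (2 c C)
  then have "\<forall>z\<in>set c. \<not> q x z" by simp
  from bump_insert_append[of c q, OF this] show ?case using 2(2) by auto
next
  case (3 c C d D)
  have c: "\<forall>z\<in>set c. \<not> q x z" and d: "\<forall>z\<in>set d. q x z \<longleftrightarrow> q' x z" using 3(2) by simp_all
  show ?case
  proof (cases rule: line_cases[of d q' x])
    case append
    have "\<forall>z\<in>set (c @ d). \<not> q x z" using append c d by auto
    from bump_insert_append[of _ q, OF this] bump_insert_append[of d q', OF append] show ?thesis
      using 3(3) by auto
  next
    case (bump u y zs)
    obtain E j where j: "bump_insert q' y D = (E, j)" by fastforce
    have IH: "bump_insert q y (append_lines C D) = (append_lines C E, j)"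
    proof (rule 3(1)[OF _ j])
      have "insert y (set (concat D)) \<subseteq> set (concat (d # D))" "set (concat C) \<subseteq> set (concat (c # C))"
        "set (concat D) \<subseteq> set (concat (d # D))"
        using bump(1) by auto
      then show "\<forall>y\<in>insert y (set (concat D)).
          (\<forall>c\<in>set (concat C). \<not> q y c) \<and> (\<forall>z\<in>set (concat D). q y z \<longleftrightarrow> q' y z)"
        using 3(2) by blast
    qed
    have u: "\<forall>z\<in>set (c @ u). \<not> q x z" "q x y" using bump c d by auto
    show ?thesis
      using bump_insert_bump[of _ q, OF u IH, of zs] bump_insert_bump[of u q', OF bump(2,3) j, of zs]
        bump(1) 3(3) by auto
  qed
qed

lemma append_to_row_append_lines:
  "i \<le> length F \<Longrightarrow> append_to_row b i (append_lines E F) = append_lines E (append_to_row b i F)"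
proof (induction E F arbitrary: i rule: append_lines.induct)
  case (3 c C d D)
  then show ?case by (cases i) auto
qed auto

lemma map_length_append_lines:
  "map length C = map length E \<Longrightarrow> map length D = map length F \<Longrightarrow>
    map length (append_lines C D) = map length (append_lines E F)"
proof (induction C D arbitrary: E F rule: append_lines.induct)
  case (3 c C d D)
  then show ?case by (cases E; cases F) auto
next
  case (2 c C)
  then show ?case by (cases E) auto
qed auto

text \<open>The lines have positive and weakly decreasing lengths, that is, they form a partition.\<close>

fun partition_shape :: "'a list list \<Rightarrow> bool" where
  "partition_shape [] \<longleftrightarrow> True"
| "partition_shape (l # ls) \<longleftrightarrow>
     l \<noteq> [] \<and> (\<forall>m\<in>set ls. length m \<le> length l) \<and> partition_shape ls"

lemma partition_shape_iff:
  "partition_shape T \<longleftrightarrow> sorted (rev (map length T)) \<and> [] \<notin> set T"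
  by (induction T) (auto simp: sorted_append)

lemma partition_shape_cong:
  assumes "map length T = map length U"
  shows "partition_shape T \<longleftrightarrow> partition_shape U"
proof -
  have nonempty: "[] \<notin> set T \<longleftrightarrow> 0 \<notin> set (map length T)" for T :: "'c list list" by auto
  show ?thesis unfolding partition_shape_iff nonempty assms ..
qed

lemma semistandard_partition_shape: "semistandard T \<Longrightarrow> partition_shape T"
proof (induction T)
  case (Cons l ls)
  then show ?case
  proof (cases ls)
    case ls: (Cons m ms)
    then have "length m \<le> length l" using Cons.prems by (simp add: above_def)
    moreover have "partition_shape ls" using Cons by simp
    ultimately show ?thesis using Cons.prems ls by fastforce
  qed simp
qed simp

lemma append_lines_length_le:
  "\<forall>c\<in>set C. length c \<le> p \<Longrightarrow> \<forall>d\<in>set D. length d \<le> r \<Longrightarrow>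
    \<forall>e\<in>set (append_lines C D). length e \<le> p + r"
  by (induction C D rule: append_lines.induct) auto

lemma partition_shape_append_lines:
  "partition_shape C \<Longrightarrow> partition_shape D \<Longrightarrow> partition_shape (append_lines C D)"
proof (induction C D rule: append_lines.induct)
  case (3 c C d D)
  then show ?case using append_lines_length_le[of C "length c" D "length d"] by auto
qed auto

lemma transpose_transpose_partition: "partition_shape T \<Longrightarrow> transpose (transpose T) = T"
  by (subst transpose_transpose) (auto simp: partition_shape_iff takeWhile_eq_all_conv)

lemma partition_shape_transpose: "partition_shape (transpose T)"
proof -
  have "[] \<notin> set (transpose T)"
    by (induction T rule: transpose.induct) auto
  then show ?thesis by (simp add: partition_shape_iff)
qed

lemma set_concat_transpose: "set (concat (transpose T)) \<subseteq> set (concat T)"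
proof
  fix x assume "x \<in> set (concat (transpose T))"
  then obtain i where i: "i < length (transpose T)" "x \<in> set (transpose T ! i)"
    by (auto simp: in_set_conv_nth[of _ "transpose T"])
  then obtain l where "l \<in> set T" "i < length l" "x = l ! i" by (auto simp: nth_transpose)
  then show "x \<in> set (concat T)" by (auto intro!: bexI[of _ l])
qed

lemma map_length_transpose:
  assumes "map length T = map length U"
  shows "map length (transpose T) = map length (transpose U)"
proof (rule nth_equalityI)
  have foldr_length: "foldr (\<lambda>xs. max (length xs)) T 0 = foldr max (map length T) 0" for T :: "'c list list"
    by (simp add: foldr_map comp_def)
  have len: "length (transpose T) = length (transpose U)"
    using assms by (simp only: length_transpose foldr_length)
  then show "length (map length (transpose T)) = length (map length (transpose U))" by simp
  have filt: "length (filter (\<lambda>ys. i < length ys) T) = length (filter (\<lambda>n. i < n) (map length T))"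
    for i and T :: "'c list list"
    by (simp add: filter_map comp_def)
  fix i assume "i < length (map length (transpose T))"
  then show "map length (transpose T) ! i = map length (transpose U) ! i"
    using len by (simp add: nth_transpose) (simp only: filt assms)
qed

section \<open>The two phases of the super correspondence\<close>

text \<open>
  In both phases, \<open>C\<close> and \<open>E\<close> are the lines present before: rows for even letters, columns for odd
  ones. They have to form a partition in the second case because only then are they recovered from
  their transposes.
\<close>

lemma super_RSK_even_phase:
  assumes "\<forall>(a, b)\<in>set S. sL a = 0 \<and> sP b = 0 \<and> (\<forall>c\<in>set (concat C). c < a)"
    and "rsk S = (D, F)"
  shows "foldl (super_RSK_step sL sP) (C, E) S = (append_lines C D, append_lines E F)"
  using assms
proof (induction S arbitrary: D F rule: rev_induct)
  case (snoc c S)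
  obtain a b where c: "c = (a, b)" by fastforce
  obtain D0 F0 where 0: "rsk S = (D0, F0)" by fastforce
  obtain D1 i where i: "bump_insert (<) a D0 = (D1, i)" by fastforce
  have DF: "D = D1" "F = append_to_row b i F0" using snoc.prems(2) 0 i c by auto
  have "set (concat D0) \<subseteq> fst ` set S" using rsk_invariants[OF 0] by blast
  then have "insert a (set (concat D0)) \<subseteq> fst ` set (S @ [c])" using c by auto
  moreover have "\<forall>y\<in>fst ` set (S @ [c]). sL y = 0 \<and> (\<forall>c\<in>set (concat C). c < y)"
    using snoc.prems(1) by (auto simp del: set_concat)
  ultimately have ok: "\<forall>y\<in>insert a (set (concat D0)). sL y = 0 \<and> (\<forall>c\<in>set (concat C). c < y)"
    by blast
  have "bump_insert (row_bumps sL) a (append_lines C D0) = (append_lines C D1, i)"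
    by (rule bump_insert_append_lines[OF _ i])
       (use ok in \<open>auto simp: row_bumps_def simp del: set_concat dest: less_asym\<close>)
  moreover have "i \<le> length F0"
    using bump_insert_index_le[OF i] rsk_length_eq[OF 0] by simp
  ultimately show ?case
    using snoc.IH[OF _ 0] snoc.prems(1) c DF
    by (simp add: row_insert_def append_to_row_append_lines)
qed simp

lemma super_RSK_odd_phase:
  assumes "\<forall>(a, b)\<in>set S. sL a = 1 \<and> sP b = 1 \<and> (\<forall>c\<in>set (concat C). c < a)"
    and "rsk S = (D, F)" and "partition_shape C" and "map length C = map length E"
  shows "foldl (super_RSK_step sL sP) (transpose C, transpose E) S =
    (transpose (append_lines C D), transpose (append_lines E F))"
  using assms(1,2)
proof (induction S arbitrary: D F rule: rev_induct)
  case (snoc c S)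
  obtain a b where c: "c = (a, b)" by fastforce
  obtain D0 F0 where 0: "rsk S = (D0, F0)" by fastforce
  obtain D1 i where i: "bump_insert (<) a D0 = (D1, i)" by fastforce
  have DF: "D = D1" "F = append_to_row b i F0" using snoc.prems(2) 0 i c by auto
  note inv = rsk_invariants[OF 0]
  have "set (concat D0) \<subseteq> fst ` set S" using inv by blast
  then have "insert a (set (concat D0)) \<subseteq> fst ` set (S @ [c])" using c by auto
  moreover have "\<forall>y\<in>fst ` set (S @ [c]). sL y = 1 \<and> (\<forall>c\<in>set (concat C). c < y)"
    using snoc.prems(1) by (auto simp del: set_concat)
  ultimately have ok: "\<forall>y\<in>insert a (set (concat D0)). sL y = 1 \<and> (\<forall>c\<in>set (concat C). c < y)"
    by blast
  have "bump_insert (col_bumps sL) a (append_lines C D0) = (append_lines C D1, i)"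
    by (rule bump_insert_append_lines[OF _ i])
       (use ok in \<open>auto simp: col_bumps_def simp del: set_concat dest: less_asym\<close>)
  moreover have "i \<le> length F0"
    using bump_insert_index_le[OF i] rsk_length_eq[OF 0] by simp
  moreover have p: "partition_shape (append_lines C D0)"
    using assms(3) inv by (blast intro: partition_shape_append_lines semistandard_partition_shape)
  moreover have "partition_shape (append_lines E F0)"
    using p partition_shape_cong[OF map_length_append_lines[OF assms(4)]] inv by blast
  ultimately show ?case
    using snoc.IH[OF _ 0] snoc.prems(1) c DF
    by (simp add: col_insert_def append_to_col_def transpose_transpose_partition
        append_to_row_append_lines)
qed simp

lemma sorted_wrt_filter_split:
  assumes "sorted_wrt r S" and "\<forall>x\<in>set S. \<forall>y\<in>set S. Q x \<and> \<not> Q y \<longrightarrow> \<not> r y x"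
  shows "S = filter Q S @ filter (\<lambda>x. \<not> Q x) S"
  using assms
proof (induction S)
  case (Cons x S)
  show ?case
  proof (cases "Q x")
    case False
    then have "\<forall>y\<in>set S. \<not> Q y" using Cons.prems by auto
    then show ?thesis using False by (auto simp: filter_id_conv filter_empty_conv)
  qed (use Cons in auto)
qed simp

text \<open>
  The columns whose lower letter has sign \<open>e\<close>; in the arrays considered, the upper letter then has
  sign \<open>e\<close> as well.
\<close>

definition sign_columns :: "('b \<Rightarrow> bit) \<Rightarrow> bit \<Rightarrow> ('a \<times> 'b) list \<Rightarrow> ('a \<times> 'b) list" where
  "sign_columns sP e S = filter (\<lambda>c. sP (snd c) = e) S"

lemma set_sign_columns: "c \<in> set (sign_columns sP e S) \<longleftrightarrow> c \<in> set S \<and> sP (snd c) = e"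
  by (auto simp: sign_columns_def)

lemma sign_columns_split:
  assumes "sorted_wrt rlex_le S"
    and "\<forall>c\<in>set S. \<forall>d\<in>set S. sP (snd c) = e \<and> sP (snd d) = e + 1 \<longrightarrow> snd c < snd d"
  shows "S = sign_columns sP e S @ sign_columns sP (e + 1) S"
proof -
  have ne: "x \<noteq> e \<longleftrightarrow> x = e + 1" for x by (cases x; cases e) auto
  have "S = filter (\<lambda>c. sP (snd c) = e) S @ filter (\<lambda>c. sP (snd c) \<noteq> e) S"
  proof (rule sorted_wrt_filter_split[OF assms(1)], intro ballI impI notI)
    fix c d assume cd: "c \<in> set S" "d \<in> set S" "sP (snd c) = e \<and> sP (snd d) \<noteq> e" "rlex_le d c"
    then have "snd c < snd d" using assms(2) ne[of "sP (snd d)"] by simp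
    then show False using rlex_le_snd[OF cd(4)] by simp
  qed
  then show ?thesis unfolding ne sign_columns_def .
qed

text \<open>
  The two alternatives of the order hypothesis. In the first, rows are inserted into the empty
  tableau and the columns of the result are lengthened; in the second, columns come first and the
  rows of the result are lengthened.
\<close>

lemma super_RSK_even_first:
  assumes "sorted_wrt rlex_le S" and "\<forall>c\<in>set S. sL (fst c) = sP (snd c)"
    and "\<forall>c\<in>set S. \<forall>d\<in>set S. sP (snd c) = 0 \<and> sP (snd d) = 1 \<longrightarrow> fst c < fst d \<and> snd c < snd d"
    and "rsk (sign_columns sP 0 S) = (T0, U0)" and "rsk (sign_columns sP 1 S) = (T1, U1)"
  shows "super_RSK sL sP S =
    (transpose (append_lines (transpose T0) T1), transpose (append_lines (transpose U0) U1))"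
proof -
  have split: "S = sign_columns sP 0 S @ sign_columns sP 1 S"
    using sign_columns_split[OF assms(1), of sP 0] assms(3) by simp
  note inv = rsk_invariants[OF assms(4)]
  have even: "foldl (super_RSK_step sL sP) ([], []) (sign_columns sP 0 S) = (T0, U0)"
    using super_RSK_even_phase[of "sign_columns sP 0 S" sL sP "[]", OF _ assms(4), of "[]"] assms(2)
    by (force simp: set_sign_columns)
  have p: "partition_shape T0" "partition_shape U0"
    using inv semistandard_partition_shape partition_shape_cong by blast+
  have C: "set (concat (transpose T0)) \<subseteq> fst ` set (sign_columns sP 0 S)"
    using set_concat_transpose[of T0] inv by blast
  have "foldl (super_RSK_step sL sP) (transpose (transpose T0), transpose (transpose U0))
      (sign_columns sP 1 S) =
    (transpose (append_lines (transpose T0) T1), transpose (append_lines (transpose U0) U1))"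
  proof (rule super_RSK_odd_phase[OF _ assms(5) partition_shape_transpose map_length_transpose])
    show "\<forall>(a, b)\<in>set (sign_columns sP 1 S). sL a = 1 \<and> sP b = 1 \<and>
        (\<forall>c\<in>set (concat (transpose T0)). c < a)"
    proof (intro ballI case_prodI2)
      fix d a b assume d: "d \<in> set (sign_columns sP 1 S)" "d = (a, b)"
      have "c < a" if c: "c \<in> set (concat (transpose T0))" for c
      proof -
        obtain c' where "c' \<in> set (sign_columns sP 0 S)" "c = fst c'" using c C by blast
        then show ?thesis using d assms(3)[rule_format, of c' d] by (simp add: set_sign_columns)
      qed
      then show "sL a = 1 \<and> sP b = 1 \<and> (\<forall>c\<in>set (concat (transpose T0)). c < a)"
        using d assms(2) by (auto simp: set_sign_columns simp del: set_concat)
    qed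
  qed (use inv in blast)
  then show ?thesis
    unfolding super_RSK_def
    by (subst split) (simp add: even transpose_transpose_partition p)
qed

lemma super_RSK_odd_first:
  assumes "sorted_wrt rlex_le S" and "\<forall>c\<in>set S. sL (fst c) = sP (snd c)"
    and "\<forall>c\<in>set S. \<forall>d\<in>set S. sP (snd c) = 1 \<and> sP (snd d) = 0 \<longrightarrow> fst c < fst d \<and> snd c < snd d"
    and "rsk (sign_columns sP 0 S) = (T0, U0)" and "rsk (sign_columns sP 1 S) = (T1, U1)"
  shows "super_RSK sL sP S = (append_lines (transpose T1) T0, append_lines (transpose U1) U0)"
proof -
  have split: "S = sign_columns sP 1 S @ sign_columns sP 0 S"
    using sign_columns_split[OF assms(1), of sP 1] assms(3) by simp
  note inv = rsk_invariants[OF assms(5)]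
  have odd: "foldl (super_RSK_step sL sP) ([], []) (sign_columns sP 1 S) = (transpose T1, transpose U1)"
    using super_RSK_odd_phase[of "sign_columns sP 1 S" sL sP "[]", OF _ assms(5), of "[]"] assms(2)
    by (force simp: set_sign_columns)
  have C: "set (concat (transpose T1)) \<subseteq> fst ` set (sign_columns sP 1 S)"
    using set_concat_transpose[of T1] inv by blast
  have "foldl (super_RSK_step sL sP) (transpose T1, transpose U1) (sign_columns sP 0 S) =
      (append_lines (transpose T1) T0, append_lines (transpose U1) U0)"
  proof (rule super_RSK_even_phase[OF _ assms(4)])
    show "\<forall>(a, b)\<in>set (sign_columns sP 0 S). sL a = 0 \<and> sP b = 0 \<and>
        (\<forall>c\<in>set (concat (transpose T1)). c < a)"
    proof (intro ballI case_prodI2)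
      fix d a b assume d: "d \<in> set (sign_columns sP 0 S)" "d = (a, b)"
      have "c < a" if c: "c \<in> set (concat (transpose T1))" for c
      proof -
        obtain c' where "c' \<in> set (sign_columns sP 1 S)" "c = fst c'" using c C by blast
        then show ?thesis using d assms(3)[rule_format, of c' d] by (simp add: set_sign_columns)
      qed
      then show "sL a = 0 \<and> sP b = 0 \<and> (\<forall>c\<in>set (concat (transpose T1)). c < a)"
        using d assms(2) by (auto simp: set_sign_columns simp del: set_concat)
    qed
  qed
  then show ?thesis
    unfolding super_RSK_def by (subst split) (simp add: odd)
qed

lemma sign_columns_exchange_rows:
  assumes "\<forall>c\<in>set S. sL (fst c) = sP (snd c)"
  shows "sign_columns sL e (exchange_rows S) = exchange_rows (sign_columns sP e S)"
  unfolding exchange_rows_unique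
proof
  have "mset (sign_columns sL e (exchange_rows S)) =
      filter_mset (\<lambda>c. sL (snd c) = e) (image_mset prod.swap (mset S))"
    by (simp add: sign_columns_def mset_exchange_rows)
  also have "\<dots> = image_mset prod.swap (filter_mset (\<lambda>c. sL (fst c) = e) (mset S))"
    by (simp add: filter_mset_image_mset comp_def)
  also have "filter_mset (\<lambda>c. sL (fst c) = e) (mset S) = filter_mset (\<lambda>c. sP (snd c) = e) (mset S)"
    using assms by (intro filter_mset_cong) auto
  finally show "mset (sign_columns sL e (exchange_rows S)) = mset (map prod.swap (sign_columns sP e S))"
    by (simp add: sign_columns_def)
  show "sorted_wrt rlex_le (sign_columns sL e (exchange_rows S))"
    unfolding sign_columns_def by (intro sorted_wrt_filter sorted_exchange_rows)
qed

section \<open>Symmetry of the super correspondence\<close>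

theorem proposition4p7:
  fixes L :: "'a::linorder set" and P :: "'b::linorder set"
    and sL :: "'a \<Rightarrow> bit" and sP :: "'b \<Rightarrow> bit"
    and S :: "('a \<times> 'b) list"
    and T :: "'a tableau" and U :: "'b tableau"
  assumes "countable L" and "countable P"
    and "set_less (sign_part sL L 0) (sign_part sL L 1) \<and>
           set_less (sign_part sP P 0) (sign_part sP P 1) \<or>
         set_less (sign_part sL L 1) (sign_part sL L 0) \<and>
           set_less (sign_part sP P 1) (sign_part sP P 0)"
    and "signed_array L sL P sP S"
    and "\<forall>c\<in>set S. pair_sign sL sP c = 0"
    and "super_RSK sL sP S = (T, U)"
  shows "super_RSK sP sL (exchange_rows S) = (U, T)"
proof -
  let ?S' = "exchange_rows S"
  have LP: "set S \<subseteq> L \<times> P" using assms(4) by (simp add: signed_array_def)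
  have "successively rlex_le S"
    using assms(4) by (auto simp: signed_array_def elim: successively_mono)
  then have sorted: "sorted_wrt rlex_le S"
    by (subst (asm) successively_conv_sorted_wrt) (auto intro: transpI rlex_le_trans)
  have "x + y = 0 \<longleftrightarrow> x = y" for x y :: bit by (cases x; cases y) auto
  then have sgn: "\<forall>c\<in>set S. sL (fst c) = sP (snd c)"
    using assms(5) by (simp add: pair_sign_def)
  have set': "set ?S' = prod.swap ` set S"
    using mset_exchange_rows[of S] by (metis set_map set_mset_mset)
  then have sgn': "\<forall>c\<in>set ?S'. sP (fst c) = sL (snd c)" using sgn by auto
  obtain T0 U0 where 0: "rsk (sign_columns sP 0 S) = (T0, U0)" by fastforce
  obtain T1 U1 where 1: "rsk (sign_columns sP 1 S) = (T1, U1)" by fastforce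
  have "sorted_wrt rlex_le (sign_columns sP e S)" for e
    unfolding sign_columns_def by (rule sorted_wrt_filter[OF sorted])
  note sym = rsk_symmetric[OF this, folded sign_columns_exchange_rows[OF sgn]]
  have sw0: "rsk (sign_columns sL 0 ?S') = (U0, T0)" by (rule sym[OF 0])
  have sw1: "rsk (sign_columns sL 1 ?S') = (U1, T1)" by (rule sym[OF 1])
  have signed: "fst c \<in> sign_part sL L (sP (snd c)) \<and> snd c \<in> sign_part sP P (sP (snd c))"
    if "c \<in> set S" for c
    using that LP sgn by (auto simp: sign_part_def)
  from assms(3) show ?thesis
  proof
    assume "set_less (sign_part sL L 0) (sign_part sL L 1) \<and>
      set_less (sign_part sP P 0) (sign_part sP P 1)"
    then have ord: "\<forall>c\<in>set S. \<forall>d\<in>set S. sP (snd c) = 0 \<and> sP (snd d) = 1 \<longrightarrow>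
        fst c < fst d \<and> snd c < snd d"
      using signed unfolding set_less_def by metis
    then have ord': "\<forall>c\<in>set ?S'. \<forall>d\<in>set ?S'. sL (snd c) = 0 \<and> sL (snd d) = 1 \<longrightarrow>
        fst c < fst d \<and> snd c < snd d"
      using sgn unfolding set' by simp
    show ?thesis
      using super_RSK_even_first[OF sorted sgn ord 0 1] assms(6)
        super_RSK_even_first[OF sorted_exchange_rows sgn' ord' sw0 sw1] by auto
  next
    assume "set_less (sign_part sL L 1) (sign_part sL L 0) \<and>
      set_less (sign_part sP P 1) (sign_part sP P 0)"
    then have ord: "\<forall>c\<in>set S. \<forall>d\<in>set S. sP (snd c) = 1 \<and> sP (snd d) = 0 \<longrightarrow>
        fst c < fst d \<and> snd c < snd d"
      using signed unfolding set_less_def by metis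
    then have ord': "\<forall>c\<in>set ?S'. \<forall>d\<in>set ?S'. sL (snd c) = 1 \<and> sL (snd d) = 0 \<longrightarrow>
        fst c < fst d \<and> snd c < snd d"
      using sgn unfolding set' by simp
    show ?thesis
      using super_RSK_odd_first[OF sorted sgn ord 0 1] assms(6)
        super_RSK_odd_first[OF sorted_exchange_rows sgn' ord' sw0 sw1] by auto
  qed
qed

end
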